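(* Let $R$ be a commutative ring with identity, let $r$ and $c_1,\dots,c_r$ be positive integers, and for $1\le i\le r$, $0\le k\le c_i$ let $x_{i,k}\in R$. Let $$A=\left(B_1\,|\,B_2\,|\,\cdots\,|\,B_r\right),\qquad B_i=\begin{pmatrix} x_{i,0}&x_{i,1}&\dots&x_{i,c_i-2}&x_{i,c_i-1}\\ x_{i,1}&x_{i,2}&\dots&x_{i,c_i-1}&x_{i,c_i}\end{pmatrix},$$ be the two-row matrix obtained by juxtaposing the $2\times c_i$ blocks $B_i$. Let $I$ be the ideal of $R$ generated by all the 2-minors of $A$. For $1\le i\le r$ let $M_i$ be the set of 2-minors of $B_i$ (with $M_i=\emptyset$ if $c_i=1$), and for $1\le i<j\le r$ let $$N_{ij}=\{x_{i,0}x_{j,c_j}-x_{i,1}x_{j,c_j-1},\ \ x_{i,c_i-1}x_{j,1}-x_{i,c_i}x_{j,0}\}.$$ Let $J$ be the ideal of $R$ generated by $$\Big(\bigcup_{i=1}^r M_i\Big)\cup\Big(\bigcup_{1\le i<j\le r}N_{ij}\Big).$$ Then $\operatorname{Rad}(I)=\operatorname{Rad}(J)$.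
   Context: $\operatorname{Rad}(I)$ denotes the radical of an ideal $I$ of $R$. The entries $x_{i,k}$ are arbitrary elements of $R$ (not necessarily indeterminates). A 2-minor is the determinant of the $2\times 2$ submatrix formed by two distinct columns. *)

theory Defs
  imports "HOL-Algebra.Ideal"
begin

definition ideal_radical :: "('a, 'm) ring_scheme \<Rightarrow> 'a set \<Rightarrow> 'a set" where
  "ideal_radical R I = {a \<in> carrier R. \<exists>n::nat. 0 < n \<and> a [^]\<^bsub>R\<^esub> n \<in> I}"

text \<open>A matrix with two rows is represented by the list of its columns, each column being the pair
  (top entry, bottom entry).  Juxtaposition of matrices is then concatenation of lists.\<close>

definition col_det :: "('a, 'm) ring_scheme \<Rightarrow> 'a \<times> 'a \<Rightarrow> 'a \<times> 'a \<Rightarrow> 'a" where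
  "col_det R u v = fst u \<otimes>\<^bsub>R\<^esub> snd v \<ominus>\<^bsub>R\<^esub> fst v \<otimes>\<^bsub>R\<^esub> snd u"

definition two_minors :: "('a, 'm) ring_scheme \<Rightarrow> ('a \<times> 'a) list \<Rightarrow> 'a set" where
  "two_minors R A = {col_det R (A ! p) (A ! q) | p q. p < q \<and> q < length A}"

definition scroll_block :: "(nat \<Rightarrow> nat) \<Rightarrow> (nat \<Rightarrow> nat \<Rightarrow> 'a) \<Rightarrow> nat \<Rightarrow> ('a \<times> 'a) list" where
  "scroll_block c x i = map (\<lambda>k. (x i k, x i (k + 1))) [0..<c i]"

definition scroll_matrix ::
    "nat \<Rightarrow> (nat \<Rightarrow> nat) \<Rightarrow> (nat \<Rightarrow> nat \<Rightarrow> 'a) \<Rightarrow> ('a \<times> 'a) list" where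
  "scroll_matrix r c x = concat (map (scroll_block c x) [1..<r + 1])"

definition corner_binomials ::
    "('a, 'm) ring_scheme \<Rightarrow> (nat \<Rightarrow> nat) \<Rightarrow> (nat \<Rightarrow> nat \<Rightarrow> 'a) \<Rightarrow> nat \<Rightarrow> nat \<Rightarrow> 'a set" where
  "corner_binomials R c x i j =
    {x i 0 \<otimes>\<^bsub>R\<^esub> x j (c j) \<ominus>\<^bsub>R\<^esub> x i 1 \<otimes>\<^bsub>R\<^esub> x j (c j - 1),
     x i (c i - 1) \<otimes>\<^bsub>R\<^esub> x j 1 \<ominus>\<^bsub>R\<^esub> x i (c i) \<otimes>\<^bsub>R\<^esub> x j 0}"

end

(* Rad J is a radical ideal K, so it suffices to put every 2-minor D of two columns u, v lying in
   different blocks x and y into K.  Let f be the first column of x and l the last column of y.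
   The Pluecker relations and det (f, l) \<in> J give D x_0 y_d \<in> K.  From x_{p+1}^2 = x_p x_{p+2}
   modulo J and radicality, the factor x_0 can be moved to any x_p with p < c, and similarly y_d to
   any y_q with q > 0.  Hence D times u_0 v_1 lies in K, by symmetry so does D times v_0 u_1, and
   therefore D^2 \<in> K. *)
theory Submission
  imports Defs
begin

section \<open>Radicals of ideals\<close>

context cring
begin

lemma ideal_minus_closed:
  assumes "ideal I R" "a \<in> I" "b \<in> I"
  shows "a \<ominus> b \<in> I"
proof -
  interpret ideal I R by fact
  show ?thesis using assms by (simp add: a_minus_def)
qed

text \<open>The multiplier \<open>z\<close> makes the induction go through without the binomial theorem.\<close>

lemma mult_power_add_mem_ideal:
  assumes I: "ideal I R" and ab: "a \<in> carrier R" "b \<in> carrier R"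
    and "z \<in> carrier R" "z \<otimes> a [^] (n::nat) \<in> I" "z \<otimes> b [^] (m::nat) \<in> I"
  shows "z \<otimes> (a \<oplus> b) [^] (n + m) \<in> I"
  using assms(4-6)
proof (induction "n + m" arbitrary: n m z)
  case 0
  then show ?case by simp
next
  case (Suc k)
  interpret ideal I R by fact
  have z: "z \<in> carrier R" by fact
  show ?case
  proof (cases "n = 0 \<or> m = 0")
    case True
    \<comment> \<open>A vanishing exponent turns one of the two hypotheses into membership of the
      bare multiplier.\<close>
    then have "z \<in> I" using Suc.prems by auto
    then show ?thesis by (simp add: I_r_closed ab)
  next
    case False
    then obtain n' m' where nm: "n = Suc n'" "m = Suc m'"
      by (metis not0_implies_Suc)
    \<comment> \<open>One factor \<open>a \<oplus> b\<close> is split off. Its summand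
      \<open>a\<close> is absorbed into the multiplier, which lowers the exponent required of
      \<open>a\<close> by one; \<open>b\<close> is treated alike.\<close>
    have "z \<otimes> a \<otimes> a [^] n' \<in> I"
      using Suc.prems ab m_comm[of a "a [^] n'"] by (simp add: nm m_assoc)
    moreover have "z \<otimes> a \<otimes> b [^] m \<in> I"
      using I_l_closed[OF Suc.prems(3), of a] z ab by (simp add: m_assoc m_lcomm)
    ultimately have 1: "z \<otimes> a \<otimes> (a \<oplus> b) [^] (n' + m) \<in> I"
      using Suc.hyps(2) z ab by (intro Suc.hyps(1)) (auto simp: nm)
    have "z \<otimes> b \<otimes> b [^] m' \<in> I"
      using Suc.prems ab m_comm[of b "b [^] m'"] by (simp add: nm m_assoc)
    moreover have "z \<otimes> b \<otimes> a [^] n \<in> I"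
      using I_l_closed[OF Suc.prems(2), of b] z ab by (simp add: m_assoc m_lcomm)
    ultimately have 2: "z \<otimes> b \<otimes> (a \<oplus> b) [^] (n + m') \<in> I"
      using Suc.hyps(2) z ab by (intro Suc.hyps(1)) (auto simp: nm)
    let ?w = "(a \<oplus> b) [^] (n' + m)"
    have "z \<otimes> (a \<oplus> b) [^] (n + m) = z \<otimes> (?w \<otimes> (a \<oplus> b))"
      by (simp add: nm)
    also have "\<dots> = z \<otimes> a \<otimes> ?w \<oplus> z \<otimes> b \<otimes> ?w"
      using z ab by (simp add: m_assoc r_distr m_comm[of a ?w] m_comm[of b ?w])
    finally show ?thesis using 1 2 by (simp add: nm)
  qed
qed

lemma ideal_radical_ideal:
  assumes I: "ideal I R"
  shows "ideal (ideal_radical R I) R"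
proof -
  interpret I: ideal I R by fact
  have add: "a \<oplus> b \<in> ideal_radical R I"
    if a: "a \<in> ideal_radical R I" and b: "b \<in> ideal_radical R I" for a b
  proof -
    obtain n m :: nat where nm: "0 < n" "a [^] n \<in> I" "0 < m" "b [^] m \<in> I"
      using a b by (auto simp: ideal_radical_def)
    have ab: "a \<in> carrier R" "b \<in> carrier R"
      using a b by (auto simp: ideal_radical_def)
    have "\<one> \<otimes> (a \<oplus> b) [^] (n + m) \<in> I"
      by (rule mult_power_add_mem_ideal[OF I]) (use nm ab in auto)
    then show ?thesis using nm ab by (auto simp: ideal_radical_def)
  qed
  have mult: "y \<otimes> a \<in> ideal_radical R I"
    if a: "a \<in> ideal_radical R I" and y: "y \<in> carrier R" for a y
    using a y by (auto simp: ideal_radical_def nat_pow_distrib intro: I.I_l_closed)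
  show ?thesis
  proof (rule idealI[OF ring_axioms])
    show "subgroup (ideal_radical R I) (add_monoid R)"
    proof (rule add.subgroupI)
      show "ideal_radical R I \<subseteq> carrier R" by (auto simp: ideal_radical_def)
      have "\<zero> \<in> ideal_radical R I"
        by (auto simp: ideal_radical_def intro!: exI[of _ "1::nat"])
      then show "ideal_radical R I \<noteq> {}" by auto
      fix a assume a: "a \<in> ideal_radical R I"
      then have "a \<in> carrier R" by (auto simp: ideal_radical_def)
      then show "\<ominus> a \<in> ideal_radical R I" using mult[OF a, of "\<ominus> \<one>"] by (simp add: l_minus)
    qed (use add in auto)
  next
    fix a y assume a: "a \<in> ideal_radical R I" and y: "y \<in> carrier R"
    show "y \<otimes> a \<in> ideal_radical R I" using mult[OF a y] .
    moreover have "a \<in> carrier R" using a by (auto simp: ideal_radical_def)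
    ultimately show "a \<otimes> y \<in> ideal_radical R I" using y by (simp add: m_comm)
  qed
qed

lemma ideal_radical_increasing:
  assumes "ideal I R"
  shows "I \<subseteq> ideal_radical R I"
proof -
  interpret ideal I R by fact
  show ?thesis
    using a_subset by (auto simp: ideal_radical_def intro!: exI[of _ "1::nat"])
qed

lemma ideal_radical_mono: "I \<subseteq> J \<Longrightarrow> ideal_radical R I \<subseteq> ideal_radical R J"
  by (auto simp: ideal_radical_def)

lemma ideal_radical_power_mem:
  assumes "a \<in> carrier R" "0 < n" "a [^] (n::nat) \<in> ideal_radical R I"
  shows "a \<in> ideal_radical R I"
  using assms by (auto simp: ideal_radical_def nat_pow_pow) (metis nat_0_less_mult_iff)

lemma ideal_radical_idem: "ideal_radical R (ideal_radical R I) \<subseteq> ideal_radical R I"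
  using ideal_radical_power_mem by (auto simp: ideal_radical_def[of R "ideal_radical R I"])

end

text \<open>Square roots are the only roots taken below. By repeated squaring this condition is
  equivalent to closure under roots of every order.\<close>

locale radical_ideal = ideal I R + cring R for I and R (structure) +
  assumes square_mem: "a \<in> carrier R \<Longrightarrow> a \<otimes> a \<in> I \<Longrightarrow> a \<in> I"

lemma (in cring) radical_ideal_ideal_radical:
  assumes "ideal I R"
  shows "radical_ideal (ideal_radical R I) R"
proof -
  interpret ideal "ideal_radical R I" R by (rule ideal_radical_ideal) fact
  show ?thesis
  proof
    fix a assume "a \<in> carrier R" "a \<otimes> a \<in> ideal_radical R I"
    then show "a \<in> ideal_radical R I"
      using ideal_radical_power_mem[of a 2] by (simp add: numeral_2_eq_2)
  qed
qed

section \<open>Columns of Hankel blocks and their determinants\<close>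

abbreviation hankel_col :: "(nat \<Rightarrow> 'a) \<Rightarrow> nat \<Rightarrow> 'a \<times> 'a" where
  "hankel_col x k \<equiv> (x k, x (Suc k))"

lemma set_scroll_matrix:
  "set (scroll_matrix r c x) = (\<Union>i\<in>{1..r}. (hankel_col (x i)) ` {..<c i})"
  using atLeastLessThanSuc_atLeastAtMost[of 1 r]
  by (simp add: scroll_matrix_def scroll_block_def atLeast0LessThan del: upt_Suc)

context cring
begin

lemma col_det_closed [simp]:
  "u \<in> carrier R \<times> carrier R \<Longrightarrow> v \<in> carrier R \<times> carrier R \<Longrightarrow> col_det R u v \<in> carrier R"
  by (auto simp: col_det_def)

lemma col_det_self:
  "u \<in> carrier R \<times> carrier R \<Longrightarrow> col_det R u u = \<zero>"
  by (auto simp: col_det_def minus_eq r_neg)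

lemma col_det_swap:
  "u \<in> carrier R \<times> carrier R \<Longrightarrow> v \<in> carrier R \<times> carrier R \<Longrightarrow>
    col_det R v u = \<ominus> col_det R u v"
  by (auto simp: col_det_def minus_add a_minus_def add.m_comm m_comm)

text \<open>Put the columns \<open>u\<close>, \<open>v\<close>, \<open>w\<close> side by side and
  repeat their top row: the resulting 3 x 3 determinant is zero, and its expansion along a repeated
  row is this identity. Repeating the bottom row gives the companion identity for
  \<open>snd\<close>.\<close>

lemma col_det_pluecker_fst:
  assumes "u \<in> carrier R \<times> carrier R" "v \<in> carrier R \<times> carrier R" "w \<in> carrier R \<times> carrier R"
  shows "col_det R u v \<otimes> fst w = col_det R w v \<otimes> fst u \<ominus> col_det R w u \<otimes> fst v"
  using assms unfolding col_det_def by (cases u; cases v; cases w) (simp, algebra)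

lemma col_det_pluecker_snd:
  assumes "u \<in> carrier R \<times> carrier R" "v \<in> carrier R \<times> carrier R" "w \<in> carrier R \<times> carrier R"
  shows "col_det R u v \<otimes> snd w = col_det R u w \<otimes> snd v \<ominus> col_det R v w \<otimes> snd u"
  using assms unfolding col_det_def by (cases u; cases v; cases w) (simp, algebra)

text \<open>An ideal does not see signs and contains zero, so neither the order of the two columns
  nor their coincidence matters. Positions in the list can thus be forgotten, which suits a matrix
  built by concatenation.\<close>

lemma col_det_set_mem_ideal:
  assumes I: "ideal I R" and A: "set A \<subseteq> carrier R \<times> carrier R" and "two_minors R A \<subseteq> I"
    and uv: "u \<in> set A" "v \<in> set A"
  shows "col_det R u v \<in> I"
proof -
  interpret ideal I R by fact
  obtain p q where p: "p < length A" "u = A ! p" and q: "q < length A" "v = A ! q"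
    using uv by (auto simp: in_set_conv_nth)
  have le: "col_det R (A ! s) (A ! t) \<in> I" if "s < t" "t < length A" for s t
    using assms(3) that by (auto simp: two_minors_def)
  have "u \<in> carrier R \<times> carrier R" "v \<in> carrier R \<times> carrier R" using A uv by auto
  then show ?thesis
    using le[of p q] le[of q p] p q col_det_self[of u] col_det_swap[of v u]
    by (cases p q rule: linorder_cases) auto
qed

lemma two_minors_subset:
  assumes "\<And>u v. u \<in> set A \<Longrightarrow> v \<in> set A \<Longrightarrow> col_det R u v \<in> I"
  shows "two_minors R A \<subseteq> I"
  unfolding two_minors_def by (auto intro!: assms nth_mem simp del: split_paired_All)

text \<open>Positive lengths make \<open>Suc (c j - 1)\<close> equal to \<open>c j\<close>. In this
  form the generators are visibly minors of the whole matrix and are open to the Pluecker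
  relations.\<close>

lemma corner_binomials_eq:
  assumes "\<And>k. k \<le> c i \<Longrightarrow> x i k \<in> carrier R" "\<And>k. k \<le> c j \<Longrightarrow> x j k \<in> carrier R"
    and "1 \<le> c i" "1 \<le> c j"
  shows "corner_binomials R c x i j =
    {col_det R (hankel_col (x i) 0) (hankel_col (x j) (c j - 1)),
     col_det R (hankel_col (x i) (c i - 1)) (hankel_col (x j) 0)}"
  using assms by (simp add: corner_binomials_def col_det_def m_comm)

end

section \<open>Minors of two blocks modulo a radical ideal\<close>

context radical_ideal
begin

text \<open>Two adjacent columns give x_{p+1}^2 = x_p x_{p+2} modulo \<open>I\<close>, so the square
  of z x_{p+1} is congruent to (z x_p)(z x_{p+2}). The induction stops before \<open>c\<close>
  because it needs the entry x_{p+2}.\<close>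

lemma hankel_shift_left:
  assumes x: "\<And>k. k \<le> c \<Longrightarrow> x k \<in> carrier R"
    and minors: "\<And>p q. p < c \<Longrightarrow> q < c \<Longrightarrow> col_det R (hankel_col x p) (hankel_col x q) \<in> I"
    and z: "z \<in> carrier R" "z \<otimes> x 0 \<in> I" and "p < c"
  shows "z \<otimes> x p \<in> I"
  using \<open>p < c\<close>
proof (induction p)
  case 0
  then show ?case using z by simp
next
  case (Suc p)
  define a b d where "a = x p" and "b = x (Suc p)" and "d = x (Suc (Suc p))"
  have abd: "a \<in> carrier R" "b \<in> carrier R" "d \<in> carrier R"
    unfolding a_def b_def d_def using x Suc.prems by simp_all
  have "col_det R (a, b) (b, d) \<in> I"
    using minors[of p "Suc p"] Suc.prems by (simp add: a_def b_def d_def)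
  then have m: "a \<otimes> d \<ominus> b \<otimes> b \<in> I" by (simp add: col_det_def)
  have za: "z \<otimes> a \<in> I" using Suc by (simp add: a_def)
  have "(z \<otimes> b) \<otimes> (z \<otimes> b) = (z \<otimes> d) \<otimes> (z \<otimes> a) \<ominus> (z \<otimes> z) \<otimes> (a \<otimes> d \<ominus> b \<otimes> b)"
    using z(1) abd by algebra
  also have "\<dots> \<in> I"
    using z(1) abd by (intro ideal_minus_closed[OF is_ideal] I_l_closed za m) auto
  finally show ?case using z(1) abd square_mem[of "z \<otimes> b"] by (simp add: b_def)
qed

text \<open>This is the left shift for the reversed sequence. Reversal runs through the columns
  backwards and exchanges their two entries, so minors go to minors up to sign.\<close>

lemma hankel_shift_right:
  assumes x: "\<And>k. k \<le> c \<Longrightarrow> x k \<in> carrier R"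
    and minors: "\<And>p q. p < c \<Longrightarrow> q < c \<Longrightarrow> col_det R (hankel_col x p) (hankel_col x q) \<in> I"
    and z: "z \<in> carrier R" "z \<otimes> x c \<in> I" and "p < c"
  shows "z \<otimes> x (Suc p) \<in> I"
proof -
  have rev_det: "col_det R (b, a) (d, b') = \<ominus> col_det R (a, b) (b', d)"
    if "a \<in> carrier R" "b \<in> carrier R" "b' \<in> carrier R" "d \<in> carrier R" for a b b' d
    using that by (simp add: col_det_def minus_add a_minus_def add.m_comm m_comm)
  \<comment> \<open>The entry \<open>x (Suc p)\<close> has index \<open>c - Suc p\<close> in the
    reversed sequence; this is below \<open>c\<close>, as the left shift demands.\<close>
  have "z \<otimes> x (c - (c - Suc p)) \<in> I"
  proof (rule hankel_shift_left[where x = "\<lambda>k. x (c - k)" and c = c])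
    fix p q assume pq: "p < c" "q < c"
    have "col_det R (hankel_col (\<lambda>k. x (c - k)) p) (hankel_col (\<lambda>k. x (c - k)) q) =
        \<ominus> col_det R (hankel_col x (c - Suc p)) (hankel_col x (c - Suc q))"
      using pq x rev_det[of "x (c - Suc p)" "x (c - p)" "x (c - Suc q)" "x (c - q)"]
      by (simp add: Suc_diff_Suc)
    then show "col_det R (hankel_col (\<lambda>k. x (c - k)) p) (hankel_col (\<lambda>k. x (c - k)) q) \<in> I"
      using minors[of "c - Suc p" "c - Suc q"] pq by simp
  qed (use x z \<open>p < c\<close> in auto)
  then show ?thesis using \<open>p < c\<close> by simp
qed

text \<open>The multiplier is the first of the two products in the determinant itself. Exchanging
  the blocks will supply the second.\<close>

lemma col_det_mult_mem:
  assumes x: "\<And>k. k \<le> c \<Longrightarrow> x k \<in> carrier R"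
    and y: "\<And>k. k \<le> d \<Longrightarrow> y k \<in> carrier R"
    and xx: "\<And>p q. p < c \<Longrightarrow> q < c \<Longrightarrow> col_det R (hankel_col x p) (hankel_col x q) \<in> I"
    and yy: "\<And>p q. p < d \<Longrightarrow> q < d \<Longrightarrow> col_det R (hankel_col y p) (hankel_col y q) \<in> I"
    and corner: "col_det R (hankel_col x 0) (hankel_col y (d - 1)) \<in> I"
    and p: "p < c" and q: "q < d"
  shows "col_det R (hankel_col x p) (hankel_col y q) \<otimes> (x p \<otimes> y (Suc q)) \<in> I"
proof -
  define u v f l where "u = hankel_col x p" and "v = hankel_col y q"
    and "f = hankel_col x 0" and "l = hankel_col y (d - 1)"
  have C: "u \<in> carrier R \<times> carrier R" "v \<in> carrier R \<times> carrier R"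
    "f \<in> carrier R \<times> carrier R" "l \<in> carrier R \<times> carrier R"
    unfolding u_def v_def f_def l_def using x y p q by auto
  then have S: "fst u \<in> carrier R" "fst v \<in> carrier R" "fst f \<in> carrier R"
    "snd v \<in> carrier R" "snd f \<in> carrier R" "snd l \<in> carrier R" by auto
  have D: "col_det R u v \<in> carrier R" using C by simp
  have fu: "col_det R f u \<in> I" and vl: "col_det R v l \<in> I" and fl: "col_det R f l \<in> I"
    unfolding u_def v_def f_def l_def using xx[of 0 p] yy[of q "d - 1"] corner p q by auto
  \<comment> \<open>The relation for \<open>f\<close>, \<open>v\<close>, \<open>l\<close> expresses
    this product by the corner det (f, l) and by det (v, l), a minor of the second block.\<close>
  have 1: "col_det R f v \<otimes> snd l \<in> I"
    unfolding col_det_pluecker_snd[OF C(3,2,4)]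
    by (intro ideal_minus_closed is_ideal I_r_closed fl vl S)
  \<comment> \<open>Now the relation for \<open>u\<close>, \<open>v\<close>, \<open>f\<close>,
    multiplied by the last entry of the second block: one term is covered by the previous step, the
    other contains det (f, u), a minor of the first block.\<close>
  have "col_det R u v \<otimes> fst f \<otimes> snd l =
      fst u \<otimes> (col_det R f v \<otimes> snd l) \<ominus> (col_det R f u \<otimes> (fst v \<otimes> snd l))"
    unfolding col_det_pluecker_fst[OF C(1,2,3)]
    using S col_det_closed[OF C(3,2)] col_det_closed[OF C(3,1)] by algebra
  also have "\<dots> \<in> I"
    using S by (intro ideal_minus_closed is_ideal I_l_closed[OF 1] I_r_closed[OF fu]) auto
  finally have *: "col_det R u v \<otimes> x 0 \<otimes> y d \<in> I"
    using q by (simp add: f_def l_def)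
  have X: "x 0 \<in> carrier R" "x p \<in> carrier R" "y d \<in> carrier R" "y (Suc q) \<in> carrier R"
    using x y p q by auto
  \<comment> \<open>The shift lemmas act on the last factor, so x_0 and later y_d are brought to the
    end in turn.\<close>
  have "col_det R u v \<otimes> y d \<otimes> x 0 \<in> I"
    using * X D by (simp add: m_assoc m_comm[of "x 0" "y d"])
  then have "col_det R u v \<otimes> y d \<otimes> x p \<in> I"
    using X D by - (rule hankel_shift_left[where x = x and c = c, OF x xx _ _ p]; simp)
  then have "col_det R u v \<otimes> x p \<otimes> y d \<in> I"
    using X D by (simp add: m_assoc m_comm[of "x p" "y d"])
  then have "col_det R u v \<otimes> x p \<otimes> y (Suc q) \<in> I"
    using X D by - (rule hankel_shift_right[where x = y and c = d, OF y yy _ _ q]; simp)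
  then show ?thesis using X D by (simp add: u_def v_def m_assoc)
qed

text \<open>Multiplying the determinant by each of its own two products lands in \<open>I\<close>,
  hence so does its square.\<close>

lemma col_det_two_blocks_mem:
  assumes x: "\<And>k. k \<le> c \<Longrightarrow> x k \<in> carrier R"
    and y: "\<And>k. k \<le> d \<Longrightarrow> y k \<in> carrier R"
    and xx: "\<And>p q. p < c \<Longrightarrow> q < c \<Longrightarrow> col_det R (hankel_col x p) (hankel_col x q) \<in> I"
    and yy: "\<And>p q. p < d \<Longrightarrow> q < d \<Longrightarrow> col_det R (hankel_col y p) (hankel_col y q) \<in> I"
    and corners: "col_det R (hankel_col x 0) (hankel_col y (d - 1)) \<in> I"
      "col_det R (hankel_col x (c - 1)) (hankel_col y 0) \<in> I"
    and p: "p < c" and q: "q < d"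
  shows "col_det R (hankel_col x p) (hankel_col y q) \<in> I"
proof -
  define D where "D = col_det R (hankel_col x p) (hankel_col y q)"
  have X: "x p \<in> carrier R" "x (Suc p) \<in> carrier R" "y q \<in> carrier R" "y (Suc q) \<in> carrier R"
    using x y p q by auto
  then have D: "D \<in> carrier R" by (simp add: D_def)
  have 1: "D \<otimes> (x p \<otimes> y (Suc q)) \<in> I"
    unfolding D_def by (rule col_det_mult_mem[where x = x and y = y and c = c and d = d, OF x y xx yy corners(1) p q])
  \<comment> \<open>With the blocks exchanged, the second corner takes the place of the first, up to
    sign.\<close>
  have "col_det R (hankel_col y 0) (hankel_col x (c - 1)) \<in> I"
    using corners(2) x y p q by (subst col_det_swap) auto
  from col_det_mult_mem[where x = y and y = x and c = d and d = c, OF y x yy xx this q p]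
  have "\<ominus> D \<otimes> (y q \<otimes> x (Suc p)) \<in> I"
    using X by (simp add: D_def col_det_swap[of "hankel_col x p"])
  then have "\<ominus> (\<ominus> D \<otimes> (y q \<otimes> x (Suc p))) \<in> I" by simp
  then have 2: "D \<otimes> (y q \<otimes> x (Suc p)) \<in> I" using X D by (simp add: l_minus)
  have "D \<otimes> D = D \<otimes> (x p \<otimes> y (Suc q) \<ominus> y q \<otimes> x (Suc p))"
    by (simp add: D_def col_det_def)
  also have "\<dots> = D \<otimes> (x p \<otimes> y (Suc q)) \<ominus> D \<otimes> (y q \<otimes> x (Suc p))"
    using X D by algebra
  also have "\<dots> \<in> I" by (intro ideal_minus_closed is_ideal 1 2)
  finally show ?thesis using square_mem[of D] D by (simp add: D_def)
qed

end

theorem theorem1: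
  fixes R :: "('a, 'm) ring_scheme" (structure)
    and r :: nat
    and c :: "nat \<Rightarrow> nat"
    and x :: "nat \<Rightarrow> nat \<Rightarrow> 'a"
  assumes "cring R"
    and "r \<ge> 1"
    and "\<And>i. i \<in> {1..r} \<Longrightarrow> c i \<ge> 1"
    and "\<And>i k. i \<in> {1..r} \<Longrightarrow> k \<le> c i \<Longrightarrow> x i k \<in> carrier R"
  shows "ideal_radical R (genideal R (two_minors R (scroll_matrix r c x))) =
         ideal_radical R (genideal R
           ((\<Union>i\<in>{1..r}. two_minors R (scroll_block c x i)) \<union>
            (\<Union>i\<in>{1..r}. \<Union>j\<in>{i<..r}. corner_binomials R c x i j)))"
proof -
  interpret cring R by fact
  note c = assms(3) and x = assms(4)
  define A where "A = scroll_matrix r c x"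
  define G where "G = (\<Union>i\<in>{1..r}. two_minors R (scroll_block c x i)) \<union>
    (\<Union>i\<in>{1..r}. \<Union>j\<in>{i<..r}. corner_binomials R c x i j)"
  have col: "hankel_col (x i) k \<in> carrier R \<times> carrier R" if "i \<in> {1..r}" "k < c i" for i k
    using x that by auto
  have A_eq: "set A = (\<Union>i\<in>{1..r}. (hankel_col (x i)) ` {..<c i})"
    unfolding A_def by (rule set_scroll_matrix)
  have A_carrier: "set A \<subseteq> carrier R \<times> carrier R"
    using col by (auto simp: A_eq)
  have block: "set (scroll_block c x i) = hankel_col (x i) ` {..<c i}" for i
    by (auto simp: scroll_block_def)
  have corner: "corner_binomials R c x i j =
      {col_det R (hankel_col (x i) 0) (hankel_col (x j) (c j - 1)),
       col_det R (hankel_col (x i) (c i - 1)) (hankel_col (x j) 0)}"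
    if "i \<in> {1..r}" "j \<in> {1..r}" for i j
    using that by (intro corner_binomials_eq x c) auto
  have minors_carrier: "two_minors R A \<subseteq> carrier R"
    using A_carrier by (intro two_minors_subset col_det_closed) auto
  define I where "I = genideal R (two_minors R A)"
  have I: "ideal I R" unfolding I_def by (rule genideal_ideal[OF minors_carrier])
  have det_I: "col_det R u v \<in> I" if "u \<in> set A" "v \<in> set A" for u v
    using that by (intro col_det_set_mem_ideal[OF I A_carrier])
      (auto simp: I_def intro: genideal_self[OF minors_carrier, THEN subsetD])
  have G_I: "G \<subseteq> I"
  proof -
    have "two_minors R (scroll_block c x i) \<subseteq> I" if "i \<in> {1..r}" for i
      using that by (intro two_minors_subset det_I) (auto simp: A_eq block)
    moreover have "corner_binomials R c x i j \<subseteq> I" if "i \<in> {1..r}" "j \<in> {1..r}" for i j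
    proof -
      \<comment> \<open>A block of length zero would have neither a first nor a last column.\<close>
      have "0 < c i" "0 < c j" using c[OF that(1)] c[OF that(2)] by auto
      then have "hankel_col (x i) 0 \<in> set A" "hankel_col (x i) (c i - 1) \<in> set A"
        "hankel_col (x j) 0 \<in> set A" "hankel_col (x j) (c j - 1) \<in> set A"
        unfolding A_eq using that by (blast intro: diff_less zero_less_one)+
      then show ?thesis unfolding corner[OF that] by (simp only: insert_subset empty_subsetI det_I)
    qed
    ultimately show ?thesis unfolding G_def by (intro Un_least UN_least) simp_all
  qed
  interpret I: ideal I R by fact
  have G_carrier: "G \<subseteq> carrier R" using G_I I.a_subset by blast
  define J where "J = genideal R G"
  have J: "ideal J R" unfolding J_def by (rule genideal_ideal[OF G_carrier])
  \<comment> \<open>It suffices to place the minors in the radical of \<open>J\<close>, where square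
    roots may be taken: forming the radical a second time adds nothing.\<close>
  define K where "K = ideal_radical R J"
  interpret K: radical_ideal K R
    unfolding K_def by (rule radical_ideal_ideal_radical[OF J])
  have G_K: "G \<subseteq> K"
    using genideal_self[OF G_carrier] ideal_radical_increasing[OF J] by (auto simp: J_def K_def)
  have same: "col_det R (hankel_col (x i) p) (hankel_col (x i) q) \<in> K"
    if "i \<in> {1..r}" "p < c i" "q < c i" for i p q
  proof (rule col_det_set_mem_ideal[OF K.is_ideal, of "scroll_block c x i"])
    show "two_minors R (scroll_block c x i) \<subseteq> K" using G_K that(1) by (simp add: G_def UN_subset_iff)
  qed (use that col in \<open>auto simp: block\<close>)
  have less: "col_det R (hankel_col (x i) p) (hankel_col (x j) q) \<in> K"
    if ij: "i \<in> {1..r}" "j \<in> {1..r}" "i < j" and pq: "p < c i" "q < c j" for i j p q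
  proof (rule K.col_det_two_blocks_mem[where x = "x i" and y = "x j" and c = "c i" and d = "c j"])
    have "corner_binomials R c x i j \<subseteq> K"
      using G_K ij by (simp add: G_def UN_subset_iff)
    then show "col_det R (hankel_col (x i) 0) (hankel_col (x j) (c j - 1)) \<in> K"
      "col_det R (hankel_col (x i) (c i - 1)) (hankel_col (x j) 0) \<in> K"
      by (simp_all add: corner[OF ij(1,2)])
  qed (use ij pq x same in auto)
  \<comment> \<open>Corner binomials are available only for i < j; the opposite order costs a sign,
    and i = j is a minor inside one block.\<close>
  have "col_det R (hankel_col (x i) p) (hankel_col (x j) q) \<in> K"
    if ij: "i \<in> {1..r}" "j \<in> {1..r}" and pq: "p < c i" "q < c j" for i j p q
  proof (cases i j rule: linorder_cases)
    case greater
    then have "\<ominus> col_det R (hankel_col (x j) q) (hankel_col (x i) p) \<in> K"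
      using less[of j i q p] ij pq by simp
    then show ?thesis
      using col_det_swap[of "hankel_col (x j) q" "hankel_col (x i) p"] col ij pq by simp
  qed (use less same that in auto)
  then have "two_minors R A \<subseteq> K"
    by (intro two_minors_subset) (auto simp: A_eq)
  then have "I \<subseteq> K" unfolding I_def by (rule genideal_minimal[OF K.is_ideal])
  \<comment> \<open>Monotonicity leads into the radical of \<open>K\<close>, which idempotence
    brings back to the radical of \<open>J\<close>.\<close>
  then have "ideal_radical R I \<subseteq> ideal_radical R J"
    using ideal_radical_mono[of I K] ideal_radical_idem[of J] by (auto simp: K_def)
  moreover have "J \<subseteq> I" unfolding J_def by (rule genideal_minimal[OF I G_I])
  then have "ideal_radical R J \<subseteq> ideal_radical R I" by (rule ideal_radical_mono)
  ultimately show ?thesis unfolding I_def J_def A_def G_def by (rule subset_antisym)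
qed

end
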